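(* Let $X$ be a complex Banach space, let $T\in\mathcal{B}(X)$, and let $D\subseteq\mathbb{C}$ be a closed subset such that $\sigma(T)=\sigma_{su}(T)\cup D$. Then $$\sigma_{desc}(T)\cup \operatorname{int}(D)=\sigma_{desc}(T,\mathcal{B}(X))\cup\operatorname{int}(D).$$
   Context: $\mathcal{B}(X)$ is the Banach algebra of all bounded linear operators on $X$. For $T\in\mathcal{B}(X)$, $\sigma(T)$ is the spectrum and $\sigma_{su}(T)=\{\lambda\in\mathbb{C}: \lambda-T \text{ is not surjective}\}$ is the surjectivity spectrum. For a linear operator $S$ on a vector space, with range $R(S)$, the descent is $d(S)=\min\{q\ge 0: R(S^q)=R(S^{q+1})\}$, with $d(S)=\infty$ if no such $q$ exists. The descent spectrum of $T$ as an operator is $\sigma_{desc}(T)=\{\lambda\in\mathbb{C}: d(\lambda-T)=\infty\}$. The descent spectrum of $T$ as an element of the algebra $\mathcal{B}(X)$ is $\sigma_{desc}(T,\mathcal{B}(X))=\{\lambda\in\mathbb{C}: d(L_{T-\lambda})=\infty\}$, where for $A\in\mathcal{B}(X)$ the operator $L_A:\mathcal{B}(X)\to\mathcal{B}(X)$ is left multiplication, $L_A(S)=AS$. $\operatorname{int}$ denotes the interior in $\mathbb{C}$. *)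

theory Defs
  imports "HOL-Analysis.Analysis" "HOL-Library.Extended_Nat"
begin

text \<open>The type classes of HOL-Analysis only provide real Banach spaces. A complex Banach space is
  a real one with a complex scalar multiplication that extends the real one and for which the norm
  is homogeneous. The zero space is not excluded.\<close>

class complex_banach = banach +
  fixes scaleC :: "complex \<Rightarrow> 'a \<Rightarrow> 'a"  (infixr "*\<^sub>C" 75)
  assumes scaleC_add_right: "a *\<^sub>C (x + y) = a *\<^sub>C x + a *\<^sub>C y"
    and scaleC_add_left: "(a + b) *\<^sub>C x = a *\<^sub>C x + b *\<^sub>C x"
    and scaleC_scaleC: "a *\<^sub>C (b *\<^sub>C x) = (a * b) *\<^sub>C x"
    and scaleC_of_real: "complex_of_real r *\<^sub>C x = r *\<^sub>R x"
    and norm_scaleC: "norm (a *\<^sub>C x) = cmod a * norm x"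

lemma scaleC_one: "1 *\<^sub>C x = (x::'a::complex_banach)"
  using scaleC_of_real[of 1 x] by simp

interpretation complex_vector: vector_space "scaleC :: complex \<Rightarrow> 'a \<Rightarrow> 'a::complex_banach"
  by standard (simp_all add: scaleC_add_right scaleC_add_left scaleC_scaleC scaleC_one)

instantiation complex :: complex_banach
begin

definition scaleC_complex :: "complex \<Rightarrow> complex \<Rightarrow> complex"
  where "scaleC_complex a x = a * x"

instance
  by standard (simp_all add: scaleC_complex_def algebra_simps scaleR_conv_of_real norm_mult)

end

text \<open>The underlying set of the algebra \<open>\<B>(X)\<close>; its multiplication is composition and its unit
  is \<^const>\<open>id\<close>. The predicate \<^const>\<open>bounded_linear\<close> alone only gives real linearity.\<close>

definition bounded_ops :: "('a::complex_banach \<Rightarrow> 'a) set"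
  where "bounded_ops = {T. bounded_linear T \<and> (\<forall>c x. T (c *\<^sub>C x) = c *\<^sub>C T x)}"

definition scalar_minus :: "complex \<Rightarrow> ('a::complex_banach \<Rightarrow> 'a) \<Rightarrow> 'a \<Rightarrow> 'a"
  where "scalar_minus z T = (\<lambda>x. z *\<^sub>C x - T x)"

definition minus_scalar :: "('a::complex_banach \<Rightarrow> 'a) \<Rightarrow> complex \<Rightarrow> 'a \<Rightarrow> 'a"
  where "minus_scalar T z = (\<lambda>x. T x - z *\<^sub>C x)"

definition spectrum :: "('a::complex_banach \<Rightarrow> 'a) \<Rightarrow> complex set"
  where "spectrum T =
    {z. \<not> (\<exists>S\<in>bounded_ops. scalar_minus z T \<circ> S = id \<and> S \<circ> scalar_minus z T = id)}"

definition surjectivity_spectrum :: "('a::complex_banach \<Rightarrow> 'a) \<Rightarrow> complex set"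
  where "surjectivity_spectrum T = {z. \<not> surj (scalar_minus z T)}"

text \<open>The descent of an operator \<open>S\<close> that maps the carrier \<open>V\<close> of a vector space into itself. The
  carrier is explicit because it is a whole type for operators on \<open>X\<close>, but \<^const>\<open>bounded_ops\<close> for
  operators on \<open>\<B>(X)\<close>.\<close>

definition descent :: "'v set \<Rightarrow> ('v \<Rightarrow> 'v) \<Rightarrow> enat"
  where "descent V S =
    (if \<exists>q. (S ^^ q) ` V = (S ^^ Suc q) ` V
     then enat (LEAST q. (S ^^ q) ` V = (S ^^ Suc q) ` V) else \<infinity>)"

definition descent_spectrum :: "('a::complex_banach \<Rightarrow> 'a) \<Rightarrow> complex set"
  where "descent_spectrum T = {z. descent UNIV (scalar_minus z T) = \<infinity>}"

definition left_mult :: "('a \<Rightarrow> 'a) \<Rightarrow> ('a \<Rightarrow> 'a) \<Rightarrow> 'a \<Rightarrow> 'a"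
  where "left_mult A S = A \<circ> S"

definition algebra_descent_spectrum :: "('a::complex_banach \<Rightarrow> 'a) \<Rightarrow> complex set"
  where "algebra_descent_spectrum T = {z. descent bounded_ops (left_mult (minus_scalar T z)) = \<infinity>}"

end

theory Submission
  imports Defs
begin

text \<open>Write \<open>S = \<lambda> - T\<close>. A factorization \<open>S ^ d = S ^ (d + 1) U\<close> in the algebra clearly makes the
  ranges of \<open>S ^ d\<close> and \<open>S ^ (d + 1)\<close> equal. For the converse, suppose that \<open>S\<close> has finite descent
  \<open>d\<close> and that \<open>\<lambda>\<close> is not interior to \<open>D\<close>. Modulo the kernel of \<open>S ^ d\<close> the operator \<open>S\<close> is onto, so
  by the open mapping argument so is \<open>S - \<mu>\<close> for small \<open>\<mu>\<close>, with uniformly bounded preimages; as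
  \<open>S - \<mu>\<close> is bijective on the kernel of \<open>S ^ d\<close> if \<open>\<mu> \<noteq> 0\<close>, it is onto on all of \<open>X\<close>. Points
  \<open>\<lambda> - \<mu>\<close> outside \<open>D\<close> accumulate at \<open>\<lambda>\<close>, and there \<open>S - \<mu>\<close> is even injective by the hypothesis on
  the spectra. Letting \<open>\<mu> \<rightarrow> 0\<close> through these points shows that the kernels of \<open>S ^ d\<close> and
  \<open>S ^ (d + 1)\<close> agree, so \<open>S\<close> is bijective on the range of \<open>S ^ d\<close>, which yields \<open>U\<close>.\<close>

section \<open>Bounded lifting\<close>

text \<open>Iteration as in the open mapping theorem: each correction halves the error, so the
  corrections form an absolutely convergent series in the Banach space \<open>'b\<close>. The
  geometric series accounts for the factor 2, and continuity of \<open>f\<close> and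
  \<open>g\<close> passes to the limit.\<close>

lemma approximate_lifting:
  fixes f :: "'a::real_normed_vector \<Rightarrow> 'w::real_normed_vector" and g :: "'b::banach \<Rightarrow> 'w"
  assumes f: "bounded_linear f" and g: "bounded_linear g"
    and approx: "\<And>x. \<exists>y e. f x = g y + f e \<and> norm y \<le> C * norm x \<and> norm e \<le> norm x / 2"
  shows "\<exists>y. f x = g y \<and> norm y \<le> 2 * C * norm x"
proof (cases "x = 0")
  case True
  then show ?thesis
    using f g by (intro exI[of _ 0]) (simp add: linear_0 bounded_linear.linear)
next
  case False
  obtain Y E where YE: "\<And>x. f x = g (Y x) + f (E x)" "\<And>x. norm (Y x) \<le> C * norm x"
      "\<And>x. norm (E x) \<le> norm x / 2"
    using approx by metis
  have "0 \<le> C * norm x"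
    using YE(2)[of x] norm_ge_zero order_trans by blast
  then have C: "C \<ge> 0"
    using False by (simp add: zero_le_mult_iff)
  define e where "e n = (E ^^ n) x" for n
  have e: "norm (e n) \<le> norm x * (1/2) ^ n" for n
    by (induction n) (use YE(3) in \<open>auto simp: e_def intro: order_trans\<close>)
  have Ye: "norm (Y (e n)) \<le> C * norm x * (1/2) ^ n" for n
    using order_trans[OF YE(2)[of "e n"] mult_left_mono[OF e[of n] C]] by (simp add: mult.assoc)
  have summable_bound: "summable (\<lambda>n. C * norm x * (1/2) ^ n :: real)"
    by (intro summable_mult) simp
  have summable_Y: "summable (\<lambda>n. norm (Y (e n)))"
    by (rule summable_comparison_test'[OF summable_bound, of 0]) (use Ye in auto)
  define y where "y = (\<Sum>n. Y (e n))"
  have "norm y \<le> (\<Sum>n. norm (Y (e n)))"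
    unfolding y_def by (rule summable_norm[OF summable_Y])
  also have "\<dots> \<le> (\<Sum>n. C * norm x * (1/2) ^ n)"
    by (rule suminf_le[OF Ye summable_Y summable_bound])
  also have "\<dots> = 2 * C * norm x"
    by (subst suminf_mult) (simp_all add: suminf_geometric)
  finally have y: "norm y \<le> 2 * C * norm x" .
  have partial: "f x = g (\<Sum>k<n. Y (e k)) + f (e n)" for n
  proof (induction n)
    case 0
    show ?case using g by (simp add: e_def linear_0 bounded_linear.linear)
  next
    case (Suc n)
    then show ?case
      using YE(1)[of "e n"] g by (simp add: linear_add bounded_linear.linear e_def)
  qed
  have "(\<lambda>n. norm x * (1/2) ^ n) \<longlonglongrightarrow> norm x * 0"
    by (intro tendsto_mult tendsto_const LIMSEQ_realpow_zero) auto
  then have "e \<longlonglongrightarrow> 0"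
    by (intro Lim_null_comparison[of e "\<lambda>n. norm x * (1/2) ^ n"]) (use e in auto)
  then have "(\<lambda>n. f (e n)) \<longlonglongrightarrow> f 0"
    by (rule bounded_linear.tendsto[OF f])
  moreover have "(\<lambda>n. g (\<Sum>k<n. Y (e k))) \<longlonglongrightarrow> g y"
    unfolding y_def using summable_norm_cancel[OF summable_Y]
    by (intro bounded_linear.tendsto[OF g] summable_LIMSEQ)
  ultimately have "(\<lambda>n. g (\<Sum>k<n. Y (e k)) + f (e n)) \<longlonglongrightarrow> g y + f 0"
    by (intro tendsto_add)
  then have "(\<lambda>n::nat. f x) \<longlonglongrightarrow> g y + f 0"
    by (simp flip: partial)
  then have "f x = g y + f 0"
    by (simp add: LIMSEQ_const_iff)
  then show ?thesis
    using y f by (auto simp: linear_0 bounded_linear.linear)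
qed

text \<open>A relative open mapping theorem. The range of \<open>g\<close> may fail to be closed, so
  Baire's theorem is applied in the domain of \<open>f\<close>, to the sets of points whose image
  has a \<open>g\<close>-preimage of norm at most \<open>n\<close>.\<close>

lemma bounded_lifting:
  fixes f :: "'a::banach \<Rightarrow> 'w::real_normed_vector" and g :: "'b::banach \<Rightarrow> 'w"
  assumes f: "bounded_linear f" and g: "bounded_linear g" and range: "range f \<subseteq> range g"
  obtains C where "C > 0" "\<And>x. \<exists>y. f x = g y \<and> norm y \<le> C * norm x"
proof -
  interpret f: bounded_linear f by (rule f)
  interpret g: bounded_linear g by (rule g)
  define V where "V n = {x. \<exists>y. f x = g y \<and> norm y \<le> real n}" for n
  have "\<exists>n. interior (closure (V n)) \<noteq> {}"
  proof (rule ccontr)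
    assume "\<not> ?thesis"
    then have "Met_TC.mtopology interior_of \<Union>(range (\<lambda>n. closure (V n))) = {}"
      by (intro Met_TC.metric_Baire_category_alt) (auto simp: complete_UNIV)
    moreover have "x \<in> \<Union>(range (\<lambda>n. closure (V n)))" for x
    proof -
      obtain y where "f x = g y" using range by blast
      then have "x \<in> V (nat \<lceil>norm y\<rceil>)"
        unfolding V_def by (auto intro!: exI[of _ y] real_nat_ceiling_ge)
      then show ?thesis using closure_subset by blast
    qed
    then have "\<Union>(range (\<lambda>n. closure (V n))) = UNIV" by blast
    ultimately show False by simp
  qed
  then obtain n x0 r where r: "r > 0" "ball x0 r \<subseteq> closure (V n)"
    by (meson all_not_in_conv mem_interior)
  \<comment> \<open>\<open>V n\<close> is convex and symmetric, so half the difference of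
    approximants of \<open>x0 + x\<close> and \<open>x0 - x\<close> is again in \<open>V n\<close>.
    This moves the ball from \<open>x0\<close> to the origin.\<close>
  have near: "\<exists>v\<in>V n. norm (x - v) < \<epsilon>" if "norm x < r" "\<epsilon> > 0" for x \<epsilon>
  proof -
    have "x0 + x \<in> closure (V n)" "x0 - x \<in> closure (V n)"
      using r(2) that by (auto simp: subset_iff dist_norm)
    then obtain a b where ab: "a \<in> V n" "b \<in> V n" "dist a (x0 + x) < \<epsilon>" "dist b (x0 - x) < \<epsilon>"
      using \<open>\<epsilon> > 0\<close> by (meson closure_approachable)
    then obtain a' b' where ab': "f a = g a'" "norm a' \<le> n" "f b = g b'" "norm b' \<le> n"
      by (auto simp: V_def)
    have "norm ((1/2) *\<^sub>R (a' - b')) \<le> n"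
      using ab' norm_triangle_ineq4[of a' b'] by simp
    then have "(1/2) *\<^sub>R (a - b) \<in> V n"
      unfolding V_def using ab'
      by (auto intro!: exI[of _ "(1/2) *\<^sub>R (a' - b')"] simp: f.diff g.diff f.scaleR g.scaleR)
    moreover have "x - (1/2) *\<^sub>R (a - b) = (1/2) *\<^sub>R ((x0 + x - a) - (x0 - x - b))"
      by (simp add: algebra_simps flip: scaleR_add_left)
    then have "norm (x - (1/2) *\<^sub>R (a - b)) < \<epsilon>"
      using ab norm_triangle_ineq4[of "x0 + x - a" "x0 - x - b"]
      by (simp add: dist_norm norm_minus_commute)
    ultimately show ?thesis by blast
  qed
  define C where "C = 2 * (real n + 1) / r"
  have C: "C > 0" using r by (simp add: C_def)
  have "\<exists>y e. f x = g y + f e \<and> norm y \<le> C * norm x \<and> norm e \<le> norm x / 2" for x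
  proof (cases "x = 0")
    case True
    then show ?thesis by (intro exI[of _ 0]) (simp add: f.zero g.zero)
  next
    case False
    \<comment> \<open>Division by \<open>t\<close> gives \<open>x\<close> the norm
      \<open>r / 2\<close>, inside the ball. An approximation within \<open>r / 4\<close> then
      leaves an error of \<open>t * (r / 4)\<close>, which is half the norm of
      \<open>x\<close>.\<close>
    define t where "t = 2 * norm x / r"
    have t: "t > 0" using False r by (simp add: t_def)
    have "norm ((1/t) *\<^sub>R x) < r" "r / 4 > 0"
      using False r by (auto simp: t_def)
    then obtain v where v: "v \<in> V n" "norm ((1/t) *\<^sub>R x - v) < r / 4"
      using near by blast
    then obtain y where y: "f v = g y" "norm y \<le> n" by (auto simp: V_def)
    have "x - t *\<^sub>R v = t *\<^sub>R ((1/t) *\<^sub>R x - v)"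
      using t by (simp add: algebra_simps)
    then have "norm (x - t *\<^sub>R v) = t * norm ((1/t) *\<^sub>R x - v)"
      using t by (metis abs_of_pos norm_scaleR)
    also have "\<dots> \<le> t * (r / 4)"
      using v t by (intro mult_left_mono) auto
    also have "\<dots> = norm x / 2"
      using r by (simp add: t_def)
    finally have e: "norm (x - t *\<^sub>R v) \<le> norm x / 2" .
    have "norm (t *\<^sub>R y) \<le> t * (real n + 1)"
      using t y by (auto intro!: mult_left_mono)
    also have "\<dots> = C * norm x"
      by (simp add: C_def t_def)
    finally have "norm (t *\<^sub>R y) \<le> C * norm x" .
    moreover have "f x = g (t *\<^sub>R y) + f (x - t *\<^sub>R v)"
      using y by (simp add: f.diff f.scaleR g.scaleR)
    ultimately show ?thesis using e by blast
  qed
  then have "\<exists>y. f x = g y \<and> norm y \<le> 2 * C * norm x" for x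
    by (rule approximate_lifting[OF f g])
  with C show ?thesis
    by (intro that[of "2 * C"]) auto
qed

section \<open>The algebra of bounded operators\<close>

lemma bounded_ops_bounded_linear: "S \<in> bounded_ops \<Longrightarrow> bounded_linear S"
  by (simp add: bounded_ops_def)

lemma bounded_ops_linear: "S \<in> bounded_ops \<Longrightarrow> linear S"
  by (simp add: bounded_ops_def bounded_linear.linear)

lemma bounded_ops_scaleC: "S \<in> bounded_ops \<Longrightarrow> S (c *\<^sub>C x) = c *\<^sub>C S x"
  by (simp add: bounded_ops_def)

lemma scaleR_scaleC_commute: "r *\<^sub>R c *\<^sub>C x = c *\<^sub>C r *\<^sub>R (x::'a::complex_banach)"
  by (simp add: scaleC_scaleC mult.commute flip: scaleC_of_real)

lemma id_bounded_ops: "id \<in> bounded_ops"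
  by (simp add: bounded_ops_def id_def)

lemma compose_bounded_ops: "A \<in> bounded_ops \<Longrightarrow> B \<in> bounded_ops \<Longrightarrow> A \<circ> B \<in> bounded_ops"
  by (auto simp: bounded_ops_def o_def intro: bounded_linear_compose)

lemma funpow_bounded_ops: "A \<in> bounded_ops \<Longrightarrow> A ^^ n \<in> bounded_ops"
  by (induction n) (simp_all add: id_bounded_ops compose_bounded_ops)

lemma uminus_bounded_ops: "A \<in> bounded_ops \<Longrightarrow> (\<lambda>x. - A x) \<in> bounded_ops"
  by (auto simp: bounded_ops_def intro: bounded_linear_minus)

lemma minus_scalar_bounded_ops:
  assumes "A \<in> bounded_ops" shows "minus_scalar A z \<in> bounded_ops"
proof -
  have "bounded_linear (\<lambda>x::'a. z *\<^sub>C x)"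
    by (rule bounded_linear_intro[of _ "cmod z"])
      (simp_all add: scaleC_add_right scaleR_scaleC_commute norm_scaleC)
  with assms show ?thesis
    by (auto simp: bounded_ops_def minus_scalar_def scaleC_scaleC mult.commute
        complex_vector.scale_right_diff_distrib intro: bounded_linear_sub)
qed

lemma scalar_minus_eq_uminus: "scalar_minus z T = (\<lambda>x. - minus_scalar T z x)"
  by (simp add: scalar_minus_def minus_scalar_def)

lemma scalar_minus_bounded_ops: "A \<in> bounded_ops \<Longrightarrow> scalar_minus z A \<in> bounded_ops"
  by (simp add: scalar_minus_eq_uminus minus_scalar_bounded_ops uminus_bounded_ops)

lemma funpow_uminus:
  fixes M :: "'a::real_vector \<Rightarrow> 'a"
  assumes "linear M"
  shows "((\<lambda>x. - M x) ^^ n) x = (-1) ^ n *\<^sub>R (M ^^ n) x"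
  by (induction n) (simp_all add: linear_scale[OF assms])

lemma funpow_left_mult: "(left_mult A ^^ n) B = (A ^^ n) \<circ> B"
  by (induction n) (auto simp: left_mult_def o_assoc)

section \<open>Operators with finite descent\<close>

lemma range_funpow_stable:
  fixes S :: "'a \<Rightarrow> 'a"
  assumes "range (S ^^ d) = range (S ^^ Suc d)"
  shows "range (S ^^ (n + d)) = range (S ^^ d)"
proof (induction n)
  case (Suc n)
  have "range (S ^^ (Suc n + d)) = S ` range (S ^^ (n + d))"
    by (simp add: image_comp)
  also have "\<dots> = S ` range (S ^^ d)"
    by (simp only: Suc)
  also have "\<dots> = range (S ^^ d)"
    by (metis assms funpow.simps(2) image_comp)
  finally show ?case .
qed simp

text \<open>\<open>S\<close> is nilpotent on the kernel of \<open>S ^^ d\<close>. In the induction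
  \<open>S z = (S - \<mu>) w\<close>, hence
  \<open>\<mu> z = S z - (S - \<mu>) z = (S - \<mu>) (w - z)\<close>, and \<open>\<mu>\<close> can
  be divided out.\<close>

lemma kernel_funpow_subset_range:
  assumes S: "S \<in> bounded_ops" and \<mu>: "\<mu> \<noteq> 0" and "(S ^^ d) z = 0"
  shows "z \<in> range (minus_scalar S \<mu>)"
  using assms(3)
proof (induction d arbitrary: z)
  case 0
  then show ?case
    using linear_0[OF bounded_ops_linear[OF minus_scalar_bounded_ops[OF S]]]
    by (metis funpow_0 rangeI)
next
  case (Suc d)
  then obtain w where w: "S z = minus_scalar S \<mu> w"
    by (force simp: funpow_Suc_right simp del: funpow.simps)
  let ?M = "minus_scalar S \<mu>"
  note M = minus_scalar_bounded_ops[OF S, of \<mu>]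
  have "?M (inverse \<mu> *\<^sub>C (w - z)) = inverse \<mu> *\<^sub>C (?M w - ?M z)"
    by (simp add: bounded_ops_scaleC[OF M] linear_diff[OF bounded_ops_linear[OF M]])
  also have "?M w - ?M z = \<mu> *\<^sub>C z"
    unfolding w[symmetric] by (simp add: minus_scalar_def)
  also have "inverse \<mu> *\<^sub>C \<mu> *\<^sub>C z = z"
    using \<mu> by (simp add: scaleC_scaleC scaleC_one)
  finally show ?case by (metis rangeI)
qed

lemma funpow_minus_scalar_commute:
  assumes S: "S \<in> bounded_ops"
  shows "(S ^^ n) (minus_scalar S \<mu> x) = minus_scalar S \<mu> ((S ^^ n) x)"
  using funpow_bounded_ops[OF S, of n]
  by (simp add: minus_scalar_def linear_diff bounded_ops_linear bounded_ops_scaleC funpow_swap1)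

text \<open>With \<open>A = S ^^ d\<close>, every small admissible \<open>\<mu>\<close> gives
  \<open>A x = - \<mu> A y\<close> with the norm of \<open>y\<close> bounded independently of
  \<open>\<mu>\<close>. Letting \<open>\<mu>\<close> tend to 0 forces
  \<open>A x = 0\<close>.\<close>

lemma kernel_funpow_stable:
  assumes S: "S \<in> bounded_ops" and range: "range (S ^^ d) = range (S ^^ Suc d)"
    and inj: "\<And>\<epsilon>. \<epsilon> > 0 \<Longrightarrow> \<exists>\<mu>. \<mu> \<noteq> 0 \<and> cmod \<mu> < \<epsilon> \<and>
      (surj (minus_scalar S \<mu>) \<longrightarrow> inj (minus_scalar S \<mu>))"
    and x: "(S ^^ Suc d) x = 0"
  shows "(S ^^ d) x = 0"
proof -
  let ?A = "S ^^ d" and ?M = "minus_scalar S"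
  have A: "?A \<in> bounded_ops" and A': "S ^^ Suc d \<in> bounded_ops" and M: "\<And>\<mu>. ?M \<mu> \<in> bounded_ops"
    by (rule funpow_bounded_ops minus_scalar_bounded_ops S)+
  have "range ?A \<subseteq> range (S ^^ Suc d)"
    using range by simp
  then obtain C where C: "C > 0" "\<And>x. \<exists>y. ?A x = (S ^^ Suc d) y \<and> norm y \<le> C * norm x"
    using bounded_lifting[OF A[THEN bounded_ops_bounded_linear] A'[THEN bounded_ops_bounded_linear]]
    by blast
  \<comment> \<open>Applying \<open>A\<close> replaces the passage to the quotient by its kernel.
    Since \<open>S y = (S - \<mu>) y + \<mu> y\<close>, a lift through \<open>A S\<close> is a lift
    through \<open>A (S - \<mu>)\<close> up to the error \<open>\<mu> y\<close>, which the bound on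
    \<open>\<mu>\<close> makes at most half as large as \<open>x\<close>.\<close>
  have lift: "\<exists>y. ?A x = ?A (?M \<mu> y) \<and> norm y \<le> 2 * C * norm x" if \<mu>: "cmod \<mu> * C \<le> 1/2" for \<mu> x
  proof -
    have "bounded_linear (\<lambda>y. ?A (?M \<mu> y))"
      by (rule bounded_linear_compose[OF A[THEN bounded_ops_bounded_linear]
            M[THEN bounded_ops_bounded_linear]])
    moreover have "\<exists>y e. ?A x = ?A (?M \<mu> y) + ?A e \<and> norm y \<le> C * norm x \<and> norm e \<le> norm x / 2" for x
    proof -
      obtain y where y: "?A x = (S ^^ Suc d) y" "norm y \<le> C * norm x"
        using C by blast
      have "?A x = ?A (S y)"
        using y by (simp add: funpow_swap1)
      also have "S y = ?M \<mu> y + \<mu> *\<^sub>C y"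
        by (simp add: minus_scalar_def)
      finally have "?A x = ?A (?M \<mu> y) + ?A (\<mu> *\<^sub>C y)"
        by (simp add: linear_add[OF bounded_ops_linear[OF A]])
      moreover have "norm (\<mu> *\<^sub>C y) \<le> norm x / 2"
      proof -
        have "norm (\<mu> *\<^sub>C y) \<le> cmod \<mu> * (C * norm x)"
          unfolding norm_scaleC by (intro mult_left_mono y) auto
        also have "\<dots> \<le> 1/2 * norm x"
          using mult_right_mono[OF \<mu>, of "norm x"] by (simp add: mult.assoc)
        finally show ?thesis by simp
      qed
      ultimately show ?thesis using y by blast
    qed
    ultimately show ?thesis
      using approximate_lifting[OF A[THEN bounded_ops_bounded_linear], of "\<lambda>y. ?A (?M \<mu> y)" C x]
      by blast
  qed
  \<comment> \<open>The lift solves the equation modulo the kernel of \<open>A\<close>; the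
    remainder lies in that kernel, hence in the range of \<open>S - \<mu>\<close>.\<close>
  have surj: "surj (?M \<mu>)" if \<mu>: "\<mu> \<noteq> 0" "cmod \<mu> * C \<le> 1/2" for \<mu>
  proof -
    have "x \<in> range (?M \<mu>)" for x
    proof -
      obtain y where "?A x = ?A (?M \<mu> y)"
        using lift[OF \<mu>(2)] by blast
      then have "?A (x - ?M \<mu> y) = 0"
        by (simp add: linear_diff[OF bounded_ops_linear[OF A]])
      then obtain w where "x - ?M \<mu> y = ?M \<mu> w"
        using kernel_funpow_subset_range[OF S \<mu>(1)] by blast
      then have "x = ?M \<mu> (y + w)"
        by (simp add: linear_add[OF bounded_ops_linear[OF M]] algebra_simps)
      then show ?thesis by blast
    qed
    then show ?thesis by blast
  qed
  obtain K where K: "K > 0" "\<And>y. norm (?A y) \<le> norm y * K"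
    using bounded_linear.pos_bounded[OF bounded_ops_bounded_linear[OF A]] by blast
  have bound: "\<exists>\<mu>. cmod \<mu> < \<epsilon> \<and> norm (?A x) \<le> cmod \<mu> * (2 * C * norm x * K)" if "\<epsilon> > 0" for \<epsilon>
  proof -
    obtain \<mu> where \<mu>: "\<mu> \<noteq> 0" "cmod \<mu> < min \<epsilon> (1 / (2 * C))" "surj (?M \<mu>) \<longrightarrow> inj (?M \<mu>)"
      using inj[of "min \<epsilon> (1 / (2 * C))"] \<open>\<epsilon> > 0\<close> C by auto
    then have \<mu>C: "cmod \<mu> * C \<le> 1/2"
      using C by (auto simp: field_simps)
    then have inj_M: "inj (?M \<mu>)"
      using \<mu> surj by blast
    obtain y where y: "?A x = ?A (?M \<mu> y)" "norm y \<le> 2 * C * norm x"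
      using lift[OF \<mu>C] by blast
    \<comment> \<open>Here \<open>S (A x) = 0\<close> enters. Both sides are brought into the form
      of \<open>S - \<mu>\<close> applied to a vector, so that injectivity cancels it.\<close>
    have "?M \<mu> (?A x) = - (\<mu> *\<^sub>C ?A x)"
      using x by (simp add: minus_scalar_def)
    also have "\<dots> = - (\<mu> *\<^sub>C ?M \<mu> (?A y))"
      using y funpow_minus_scalar_commute[OF S, of d] by simp
    also have "\<dots> = ?M \<mu> (- (\<mu> *\<^sub>C ?A y))"
      by (simp add: bounded_ops_scaleC[OF M] linear_neg[OF bounded_ops_linear[OF M]])
    finally have "?A x = - (\<mu> *\<^sub>C ?A y)"
      using inj_M by (simp add: inj_eq)
    then have "norm (?A x) = cmod \<mu> * norm (?A y)"
      by (simp add: norm_scaleC)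
    also have "\<dots> \<le> cmod \<mu> * (2 * C * norm x * K)"
      using order_trans[OF K(2)[of y] mult_right_mono[OF y(2), of K]] K
      by (intro mult_left_mono) auto
    finally show ?thesis using \<mu> by auto
  qed
  have "norm (?A x) \<le> 0 + \<epsilon>" if "\<epsilon> > 0" for \<epsilon>
  proof -
    define B where "B = 2 * C * norm x * K"
    have B: "B \<ge> 0" using C K by (simp add: B_def)
    \<comment> \<open>\<open>B + 1\<close> avoids a division by zero when
      \<open>x = 0\<close>.\<close>
    then have "\<epsilon> / (B + 1) > 0" using that by simp
    then obtain \<mu> where \<mu>: "cmod \<mu> < \<epsilon> / (B + 1)" "norm (?A x) \<le> cmod \<mu> * B"
      using bound unfolding B_def by blast
    note \<mu>(2)
    also have "cmod \<mu> * B \<le> cmod \<mu> * (B + 1)"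
      by (intro mult_left_mono) auto
    also have "\<dots> \<le> \<epsilon>"
      using \<mu>(1) B by (simp add: field_simps)
    finally show ?thesis by simp
  qed
  then show ?thesis
    using field_le_epsilon[of "norm (?A x)" 0] by simp
qed

text \<open>\<open>S ^^ Suc d\<close> maps the range of \<open>S ^^ d\<close> bijectively onto
  itself, by stability of ranges and kernels. \<open>U x\<close> is the unique point of that range
  sent to \<open>(S ^^ d) x\<close>: uniqueness makes \<open>U\<close> linear, bounded lifting makes
  it bounded.\<close>

lemma finite_descent_imp_factorization:
  assumes S: "S \<in> bounded_ops" and range: "range (S ^^ d) = range (S ^^ Suc d)"
    and kernel: "\<And>x. (S ^^ Suc d) x = 0 \<Longrightarrow> (S ^^ d) x = 0"
  obtains U where "U \<in> bounded_ops" "S ^^ d = S ^^ Suc d \<circ> U"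
proof -
  let ?A = "S ^^ d"
  have A: "\<And>n. S ^^ n \<in> bounded_ops"
    by (rule funpow_bounded_ops S)+
  note blin = A[THEN bounded_ops_bounded_linear]
  have lin: "\<And>n. linear (S ^^ n)"
    using A bounded_ops_linear by blast
  have kernel': "?A x = 0" if "(S ^^ (n + d)) x = 0" for n x
    using that
  proof (induction n arbitrary: x)
    case (Suc n)
    then have "(S ^^ (n + d)) (S x) = 0"
      by (simp add: funpow_swap1)
    then have "?A (S x) = 0" by (rule Suc.IH)
    then show ?case
      by (intro kernel) (simp add: funpow_swap1)
  qed simp
  have unique: "u = v"
    if uv: "u \<in> range ?A" "v \<in> range ?A" "(S ^^ Suc d) u = (S ^^ Suc d) v" for u v
  proof -
    obtain a b where ab: "u = ?A a" "v = ?A b" using uv by blast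
    have "(S ^^ (Suc d + d)) (a - b) = (S ^^ Suc d) (u - v)"
      by (simp only: funpow_add o_apply ab linear_diff[OF lin])
    also have "\<dots> = 0"
      by (simp only: linear_diff[OF lin] uv(3) diff_self)
    finally have "?A (a - b) = 0" by (rule kernel')
    then show ?thesis by (simp add: ab linear_diff[OF lin])
  qed
  \<comment> \<open>The surplus exponent \<open>d\<close> places the solution \<open>?A w\<close> in
    the range of \<open>?A\<close>, where solutions are unique.\<close>
  have "range ?A \<subseteq> range (S ^^ (Suc d + d))"
    using range_funpow_stable[OF range, of "Suc d"] by simp
  then obtain C where C: "C > 0" "\<And>x. \<exists>w. ?A x = (S ^^ (Suc d + d)) w \<and> norm w \<le> C * norm x"
    using bounded_lifting[OF blin blin] by blast
  then obtain W where W: "\<And>x. ?A x = (S ^^ (Suc d + d)) (W x)" "\<And>x. norm (W x) \<le> C * norm x"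
    by metis
  \<comment> \<open>The choice \<open>W\<close> may be nonlinear; its ambiguity disappears after
    applying \<open>?A\<close>.\<close>
  define U where "U x = ?A (W x)" for x
  have U: "?A x = (S ^^ Suc d) (U x)" for x
    unfolding W(1)[of x] U_def by (simp only: funpow_add o_apply)
  have U_eqI: "U x = ?A a" if "?A x = (S ^^ Suc d) (?A a)" for x a
    by (rule unique[OF _ _ trans[OF U[symmetric] that]]) (simp_all only: U_def rangeI)
  obtain K where K: "K > 0" "\<And>y. norm (?A y) \<le> norm y * K"
    using bounded_linear.pos_bounded[OF blin] by blast
  have "bounded_linear U"
  proof (rule bounded_linear_intro[of _ "C * K"])
    show "U (x + y) = U x + U y" for x y
      unfolding U_def[of x] U_def[of y] linear_add[OF lin, symmetric]
      by (rule U_eqI) (simp only: linear_add[OF lin] U[of x, unfolded U_def] U[of y, unfolded U_def])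
    show "U (r *\<^sub>R x) = r *\<^sub>R U x" for r x
      unfolding U_def[of x] linear_scale[OF lin, symmetric]
      by (rule U_eqI) (simp only: linear_scale[OF lin] U[of x, unfolded U_def])
    show "norm (U x) \<le> norm x * (C * K)" for x
      using order_trans[OF K(2)[of "W x"] mult_right_mono[OF W(2)[of x], of K]] K
      by (simp add: U_def mult_ac)
  qed
  moreover have "U (c *\<^sub>C x) = c *\<^sub>C U x" for c x
    unfolding U_def[of x] bounded_ops_scaleC[OF A, symmetric]
    by (rule U_eqI) (simp only: bounded_ops_scaleC[OF A] U[of x, unfolded U_def])
  ultimately have "U \<in> bounded_ops"
    by (simp add: bounded_ops_def)
  moreover have "?A = S ^^ Suc d \<circ> U"
    by (rule ext) (unfold o_apply, rule U)
  ultimately show ?thesis by (rule that)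
qed

section \<open>The two descent spectra\<close>

lemma descent_eq_infinity_iff:
  "descent V S = \<infinity> \<longleftrightarrow> (\<nexists>q. (S ^^ q) ` V = (S ^^ Suc q) ` V)"
  by (auto simp: descent_def)

text \<open>Both images are right ideals generated by powers of \<open>M\<close>. Evaluation at
  \<open>id\<close> yields \<open>U\<close>, and conversely \<open>M ^^ q \<circ> B\<close> is
  \<open>M ^^ Suc q\<close> applied to \<open>U \<circ> B\<close>.\<close>

lemma left_mult_range_eq_iff:
  assumes M: "M \<in> bounded_ops"
  shows "(left_mult M ^^ q) ` bounded_ops = (left_mult M ^^ Suc q) ` bounded_ops
    \<longleftrightarrow> (\<exists>U\<in>bounded_ops. M ^^ q = M ^^ Suc q \<circ> U)"
proof
  assume eq: "(left_mult M ^^ q) ` bounded_ops = (left_mult M ^^ Suc q) ` bounded_ops"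
  have "(left_mult M ^^ q) id \<in> (left_mult M ^^ q) ` bounded_ops"
    by (intro imageI id_bounded_ops)
  then have "(left_mult M ^^ q) id \<in> (left_mult M ^^ Suc q) ` bounded_ops"
    by (simp only: eq)
  then show "\<exists>U\<in>bounded_ops. M ^^ q = M ^^ Suc q \<circ> U"
    unfolding funpow_left_mult by auto
next
  assume "\<exists>U\<in>bounded_ops. M ^^ q = M ^^ Suc q \<circ> U"
  then obtain U where U: "U \<in> bounded_ops" "M ^^ q = M ^^ Suc q \<circ> U" by blast
  have "M ^^ q \<circ> B \<in> (\<lambda>B. M ^^ Suc q \<circ> B) ` bounded_ops" if "B \<in> bounded_ops" for B
    using that U(1) by (subst U(2)) (auto simp only: o_assoc[symmetric] intro!: imageI compose_bounded_ops)
  moreover have "M ^^ Suc q \<circ> B \<in> (\<lambda>B. M ^^ q \<circ> B) ` bounded_ops" if "B \<in> bounded_ops" for B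
    unfolding funpow_Suc_right o_assoc[symmetric]
    using that M by (intro imageI compose_bounded_ops)
  ultimately show "(left_mult M ^^ q) ` bounded_ops = (left_mult M ^^ Suc q) ` bounded_ops"
    unfolding funpow_left_mult by blast
qed

text \<open>The two sides acquire the signs \<open>(-1) ^ q\<close> and \<open>(-1) ^ Suc q\<close>,
  so \<open>- U\<close> takes the place of \<open>U\<close>. This reconciles \<open>z - T\<close> in
  \<open>descent_spectrum\<close> with \<open>T - z\<close> in
  \<open>algebra_descent_spectrum\<close>.\<close>

lemma factorization_uminus:
  assumes M: "M \<in> bounded_ops" and U: "U \<in> bounded_ops" "M ^^ q = M ^^ Suc q \<circ> U"
  shows "\<exists>U\<in>bounded_ops. (\<lambda>x. - M x) ^^ q = (\<lambda>x. - M x) ^^ Suc q \<circ> U"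
proof -
  note lin = bounded_ops_linear[OF M]
  have eq: "((\<lambda>x. - M x) ^^ q) x = ((\<lambda>x. - M x) ^^ Suc q) (- U x)" for x
    using fun_cong[OF U(2), of x]
    unfolding funpow_uminus[OF lin] linear_neg[OF bounded_ops_linear[OF funpow_bounded_ops[OF M]]]
    by simp
  show ?thesis
    by (intro bexI[OF _ uminus_bounded_ops[OF U(1)]] ext) (unfold o_apply, rule eq)
qed

lemma algebra_descent_spectrum_iff:
  assumes T: "T \<in> bounded_ops"
  shows "z \<in> algebra_descent_spectrum T \<longleftrightarrow>
    (\<nexists>q. \<exists>U\<in>bounded_ops. scalar_minus z T ^^ q = scalar_minus z T ^^ Suc q \<circ> U)"
proof -
  have eq: "(\<exists>U\<in>bounded_ops. minus_scalar T z ^^ q = minus_scalar T z ^^ Suc q \<circ> U) \<longleftrightarrow>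
    (\<exists>U\<in>bounded_ops. scalar_minus z T ^^ q = scalar_minus z T ^^ Suc q \<circ> U)" (is "?L \<longleftrightarrow> ?R") for q
  proof
    show ?R if ?L
      using that factorization_uminus[OF minus_scalar_bounded_ops[OF T]]
      unfolding scalar_minus_eq_uminus by blast
    have "minus_scalar T z = (\<lambda>x. - scalar_minus z T x)"
      by (simp add: scalar_minus_eq_uminus)
    then show ?L if ?R
      using that factorization_uminus[OF scalar_minus_bounded_ops[OF T]] by metis
  qed
  then show ?thesis
    by (simp only: algebra_descent_spectrum_def descent_eq_infinity_iff mem_Collect_eq eq
        left_mult_range_eq_iff[OF minus_scalar_bounded_ops[OF T]])
qed

lemma descent_spectrum_subset_algebra:
  assumes T: "T \<in> bounded_ops"
  shows "descent_spectrum T \<subseteq> algebra_descent_spectrum T"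
proof
  fix z assume z: "z \<in> descent_spectrum T"
  let ?S = "scalar_minus z T"
  have "range (?S ^^ q) = range (?S ^^ Suc q)" if "?S ^^ q = ?S ^^ Suc q \<circ> U" for q U
  proof
    show "range (?S ^^ q) \<subseteq> range (?S ^^ Suc q)"
      by (subst that) auto
    show "range (?S ^^ Suc q) \<subseteq> range (?S ^^ q)"
      unfolding funpow_Suc_right by auto
  qed
  with z show "z \<in> algebra_descent_spectrum T"
    unfolding algebra_descent_spectrum_iff[OF T] descent_spectrum_def descent_eq_infinity_iff
    by blast
qed

lemma notin_spectrum_imp_inj: "z \<notin> spectrum T \<Longrightarrow> inj (scalar_minus z T)"
  unfolding spectrum_def by clarsimp (metis inj_on_id inj_on_imageI2)

lemma minus_scalar_scalar_minus: "minus_scalar (scalar_minus z T) \<mu> = scalar_minus (z - \<mu>) T"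
  by (simp add: minus_scalar_def scalar_minus_def fun_eq_iff complex_vector.scale_left_diff_distrib)

theorem theorem1:
  fixes T :: "'a::complex_banach \<Rightarrow> 'a" and D :: "complex set"
  assumes "T \<in> bounded_ops"
    and "closed D"
    and "spectrum T = surjectivity_spectrum T \<union> D"
  shows "descent_spectrum T \<union> interior D = algebra_descent_spectrum T \<union> interior D"
proof -
  have "z \<in> descent_spectrum T" if z: "z \<in> algebra_descent_spectrum T" "z \<notin> interior D" for z
  proof (rule ccontr)
    assume "z \<notin> descent_spectrum T"
    let ?S = "scalar_minus z T"
    have S: "?S \<in> bounded_ops" by (rule scalar_minus_bounded_ops[OF assms(1)])
    obtain d where d: "range (?S ^^ d) = range (?S ^^ Suc d)"
      using \<open>z \<notin> descent_spectrum T\<close> by (auto simp: descent_spectrum_def descent_eq_infinity_iff)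
    have "\<exists>\<mu>. \<mu> \<noteq> 0 \<and> cmod \<mu> < \<epsilon> \<and> (surj (minus_scalar ?S \<mu>) \<longrightarrow> inj (minus_scalar ?S \<mu>))"
      if "\<epsilon> > 0" for \<epsilon>
    proof -
      have "z \<in> closure (- D)"
        using z(2) by (simp add: closure_complement)
      \<comment> \<open>Nonempty open sets in the plane have no isolated points, so \<open>z\<close>
        is a limit point even if it lies outside \<open>D\<close>. This ensures
        \<open>\<mu> \<noteq> 0\<close>.\<close>
      then have "z islimpt - D"
        using \<open>closed D\<close> by (metis open_Compl closure_def UnE mem_Collect_eq open_imp_islimpt)
      then obtain \<nu> where \<nu>: "\<nu> \<notin> D" "\<nu> \<noteq> z" "dist \<nu> z < \<epsilon>"
        using \<open>\<epsilon> > 0\<close> unfolding islimpt_approachable by blast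
      \<comment> \<open>If \<open>\<nu> - T\<close> is onto, then \<open>\<nu>\<close> lies neither
        in the surjectivity spectrum nor in \<open>D\<close>, hence not in the spectrum.\<close>
      have "inj (scalar_minus \<nu> T)" if "surj (scalar_minus \<nu> T)"
        using that \<nu> assms(3) by (intro notin_spectrum_imp_inj) (simp add: surjectivity_spectrum_def)
      then show ?thesis
        \<comment> \<open>With \<open>\<mu> = z - \<nu>\<close>, the operator
          \<open>S - \<mu>\<close> is exactly \<open>\<nu> - T\<close>.\<close>
        using \<nu> by (intro exI[of _ "z - \<nu>"])
          (auto simp: minus_scalar_scalar_minus dist_norm norm_minus_commute)
    qed
    then have "(?S ^^ d) x = 0" if "(?S ^^ Suc d) x = 0" for x
      using kernel_funpow_stable[OF S d] that by blast
    then obtain U where "U \<in> bounded_ops" "?S ^^ d = ?S ^^ Suc d \<circ> U"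
      using finite_descent_imp_factorization[OF S d] by blast
    then show False
      using z(1) unfolding algebra_descent_spectrum_iff[OF assms(1)] by blast
  qed
  then show ?thesis
    using descent_spectrum_subset_algebra[OF assms(1)] by blast
qed

end
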